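(* For every integer $n>1$, the number of non-strictly bispecial Sturmian words of length $n$ over the alphabet $\{a,b\}$ is exactly $2(n+1-\phi(n+2))$, where $\phi$ is the Euler totient function.
   Context: Words are finite and over the alphabet $\Sigma=\{a,b\}$; $|u|_a$ is the number of occurrences of the letter $a$ in $u$; a factor is a contiguous subword. A word $w\in\Sigma^*$ is Sturmian if it is balanced: for any two factors $u,v$ of $w$ of the same length, $\big||u|_a-|v|_a\big|\le 1$. Let $St$ be the set of (finite) Sturmian words. A word $w\in St$ is left special if $aw,bw\in St$, right special if $wa,wb\in St$, and bispecial if it is both left and right special. A bispecial Sturmian word $w$ is strictly bispecial if $awa,awb,bwa,bwb$ are all in $St$; otherwise it is non-strictly bispecial. $\phi(m)$ is the number of positive integers smaller than or equal to $m$ and coprime with $m$. *)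

theory Defs
  imports Main "HOL-Library.Sublist" "HOL-Number_Theory.Totient"
begin

datatype letter = A | B

type_synonym word = "letter list"

text \<open>Factors are contiguous subwords; this is \<^const>\<open>sublist\<close> of
  \<^theory>\<open>HOL-Library.Sublist\<close> (not \<^const>\<open>subseq\<close>). The number of
  occurrences of a letter is taken in \<^typ>\<open>int\<close> so that the
  difference is not truncated.\<close>

definition sturmian :: "word \<Rightarrow> bool" where
  "sturmian w \<longleftrightarrow>
     (\<forall>u v. sublist u w \<longrightarrow> sublist v w \<longrightarrow> length u = length v \<longrightarrow>
        \<bar>int (count_list u A) - int (count_list v A)\<bar> \<le> 1)"

definition left_special :: "word \<Rightarrow> bool" where
  "left_special w \<longleftrightarrow> sturmian w \<and> sturmian (A # w) \<and> sturmian (B # w)"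

definition right_special :: "word \<Rightarrow> bool" where
  "right_special w \<longleftrightarrow> sturmian w \<and> sturmian (w @ [A]) \<and> sturmian (w @ [B])"

definition bispecial :: "word \<Rightarrow> bool" where
  "bispecial w \<longleftrightarrow> left_special w \<and> right_special w"

definition strictly_bispecial :: "word \<Rightarrow> bool" where
  "strictly_bispecial w \<longleftrightarrow> bispecial w \<and>
     sturmian (A # w @ [A]) \<and> sturmian (A # w @ [B]) \<and>
     sturmian (B # w @ [A]) \<and> sturmian (B # w @ [B])"

definition nonstrictly_bispecial :: "word \<Rightarrow> bool" where
  "nonstrictly_bispecial w \<longleftrightarrow> bispecial w \<and> \<not> strictly_bispecial w"

end

theory Submission
  imports Defs
begin

text \<open>Let \<open>h\<close> and \<open>h'\<close> be the prefix counts of the letter \<open>A\<close> in \<open>w\<close> and in its reversal.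
  Left and right speciality say that \<open>h\<close> and \<open>h'\<close> are additive up to an error in \<open>{0, 1}\<close>.
  A Euclidean argument on slopes shows that \<open>h \<ge> h'\<close> or \<open>h \<le> h'\<close> everywhere, and that in the
  first case \<open>B w A\<close> (in the second, \<open>B (rev w) A\<close>) is the digitization of a segment from the
  origin with \<open>q\<close> letters \<open>A\<close> among \<open>N = n + 2\<close>, where \<open>0 < q < N\<close>, i.e. a power of a Christoffel word.
  If \<open>q\<close> and \<open>N\<close> are coprime, then \<open>w\<close> is a palindrome and strictly bispecial; otherwise the
  segment meets an inner lattice point, where \<open>h\<close> and \<open>h'\<close> differ, so \<open>A w B\<close> is unbalanced and
  \<open>w \<noteq> rev w\<close>. Hence there are two words for each \<open>q\<close> not coprime to \<open>N\<close>.\<close>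

section \<open>Prefix counts and balance\<close>

definition height :: "word \<Rightarrow> nat \<Rightarrow> int" where
  "height w k = int (count_list (take k w) A)"

lemma height_0 [simp]: "height w 0 = 0"
  by (simp add: height_def)

lemma height_Cons [simp]: "height (x # w) (Suc k) = (if x = A then 1 else 0) + height w k"
  by (simp add: height_def)

lemma height_Suc:
  "k < length w \<Longrightarrow> height w (Suc k) = height w k + (if w ! k = A then 1 else 0)"
  by (simp add: height_def take_Suc_conv_app_nth)

lemma height_append: "k \<le> length u \<Longrightarrow> height (u @ v) k = height u k"
  by (simp add: height_def)

lemma height_snoc:
  "height (w @ [x]) (Suc (length w)) = height w (length w) + (if x = A then 1 else 0)"
  by (simp add: height_def)

lemma height_rev:
  assumes "k \<le> length w"
  shows "height (rev w) k = height w (length w) - height w (length w - k)"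
proof -
  have "count_list w A
      = count_list (take (length w - k) w) A + count_list (drop (length w - k) w) A"
    by (metis append_take_drop_id count_list_append)
  then show ?thesis
    using assms by (simp add: height_def take_rev)
qed

lemma height_eqI:
  assumes len: "length v = length w"
    and eq: "\<And>k. k \<le> length w \<Longrightarrow> height v k = height w k"
  shows "v = w"
proof (rule nth_equalityI[OF len])
  fix k assume k: "k < length v"
  have "(if v ! k = A then 1 else 0) = (if w ! k = A then 1 else (0::int))"
    using height_Suc[of k v] height_Suc[of k w] eq[of k] eq[of "Suc k"] k len by simp
  then show "v ! k = w ! k"
    by (cases "v ! k"; cases "w ! k") auto
qed

lemma count_list_take_drop:
  "int (count_list (take m (drop i w)) A) = height w (i + m) - height w i"
  by (simp add: height_def take_add)

text \<open>The count of a factor is a difference of two prefix counts. A one-sided bound suffices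
  because the two windows can be exchanged.\<close>

lemma sturmian_iff_height:
  "sturmian w \<longleftrightarrow>
     (\<forall>i j m. i + m \<le> length w \<longrightarrow> j + m \<le> length w \<longrightarrow>
        height w (i + m) - height w i \<le> height w (j + m) - height w j + 1)"
    (is "_ \<longleftrightarrow> ?R")
proof
  assume st: "sturmian w"
  show ?R
  proof (intro allI impI)
    fix i j m assume m: "i + m \<le> length w" "j + m \<le> length w"
    have "sublist (take m (drop i w)) w" "sublist (take m (drop j w)) w"
      by (meson sublist_drop sublist_order.order_trans sublist_take)+
    moreover have "length (take m (drop i w)) = length (take m (drop j w))"
      using m by simp
    ultimately have "\<bar>int (count_list (take m (drop i w)) A)
        - int (count_list (take m (drop j w)) A)\<bar> \<le> 1"
      using st unfolding sturmian_def by blast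
    then show "height w (i + m) - height w i \<le> height w (j + m) - height w j + 1"
      unfolding count_list_take_drop by linarith
  qed
next
  assume R: ?R
  have *: "\<exists>i. i + length u \<le> length w
      \<and> int (count_list u A) = height w (i + length u) - height w i" if "sublist u w" for u
  proof -
    from that obtain ps ss where "w = ps @ u @ ss"
      by (auto simp: sublist_def)
    then show ?thesis by (intro exI[of _ "length ps"]) (simp add: height_def)
  qed
  show "sturmian w"
    unfolding sturmian_def
  proof (intro allI impI)
    fix u v assume uv: "sublist u w" "sublist v w" "length u = length v"
    obtain i where i: "i + length u \<le> length w"
      "int (count_list u A) = height w (i + length u) - height w i"
      using *[OF uv(1)] by blast
    obtain j where j: "j + length u \<le> length w"
      "int (count_list v A) = height w (j + length u) - height w j"
      using *[OF uv(2)] uv(3) by auto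
    have "height w (i + length u) - height w i \<le> height w (j + length u) - height w j + 1"
      "height w (j + length u) - height w j \<le> height w (i + length u) - height w i + 1"
      using R i(1) j(1) by blast+
    then show "\<bar>int (count_list u A) - int (count_list v A)\<bar> \<le> 1"
      using i(2) j(2) by linarith
  qed
qed

text \<open>Windows of length 0 or of full length are unique up to their count, and at every other
  length the counts take at most two consecutive values. Indexing \<open>c\<close> by the length
  minus one matches \<open>quasi_additive\<close>.\<close>

lemma sturmianI:
  assumes "\<And>i j. Suc j < length w \<Longrightarrow> i + Suc j \<le> length w \<Longrightarrow>
      c j \<le> height w (i + Suc j) - height w i \<and> height w (i + Suc j) - height w i \<le> c j + 1"
  shows "sturmian w"
  unfolding sturmian_iff_height
proof (intro allI impI)
  fix i j m assume m: "i + m \<le> length w" "j + m \<le> length w"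
  consider "m = 0" | "m = length w" | k where "m = Suc k" "Suc k < length w"
    using m by (cases m) fastforce+
  then show "height w (i + m) - height w i \<le> height w (j + m) - height w j + 1"
  proof cases
    case 3
    then show ?thesis using assms[of k i] assms[of k j] m by simp
  qed (use m in auto)
qed

lemma sturmian_sublist: "sturmian w \<Longrightarrow> sublist u w \<Longrightarrow> sturmian u"
  unfolding sturmian_def by (meson sublist_order.order_trans)

lemma sturmian_rev [simp]: "sturmian (rev w) \<longleftrightarrow> sturmian w"
proof -
  have "sturmian (rev w)" if "sturmian w" for w
    unfolding sturmian_def
  proof (intro allI impI)
    fix u v assume uv: "sublist u (rev w)" "sublist v (rev w)" "length u = length v"
    then have "sublist (rev u) w" "sublist (rev v) w"
      by (metis rev_rev_ident sublist_rev)+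
    then have "\<bar>int (count_list (rev u) A) - int (count_list (rev v) A)\<bar> \<le> 1"
      using that uv(3) unfolding sturmian_def by (metis length_rev)
    then show "\<bar>int (count_list u A) - int (count_list v A)\<bar> \<le> 1" by simp
  qed
  from this[of w] this[of "rev w"] show ?thesis by auto
qed

section \<open>Special words and quasi-additivity\<close>

text \<open>The index is shifted by one: for the prefix counts of a word \<open>w\<close>, the value at \<open>i\<close>
  belongs to the prefix of length \<open>i + 1\<close> of \<open>B # w\<close>.\<close>

definition quasi_additive :: "nat \<Rightarrow> (nat \<Rightarrow> int) \<Rightarrow> bool" where
  "quasi_additive n f \<longleftrightarrow>
     (\<forall>i j. i + j < n \<longrightarrow> f i + f j \<le> f (Suc (i + j)) \<and> f (Suc (i + j)) \<le> f i + f j + 1)"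

lemma quasi_additiveD:
  assumes "quasi_additive n f" "i + j < n"
  shows "f i + f j \<le> f (Suc (i + j))" "f (Suc (i + j)) \<le> f i + f j + 1"
  using assms by (auto simp: quasi_additive_def)

text \<open>The prefixes of length \<open>j + 1\<close> of \<open>A # w\<close> and
  \<open>B # w\<close> have counts \<open>height w j + 1\<close> and \<open>height w j\<close>.
  Balance against a window of \<open>w\<close> starting at \<open>i\<close> gives the two bounds;
  conversely, the bounds confine all windows to these two values.\<close>

lemma left_special_iff: "left_special w \<longleftrightarrow> quasi_additive (length w) (height w)"
proof
  assume "left_special w"
  then have st: "sturmian (A # w)" "sturmian (B # w)"
    by (auto simp: left_special_def)
  show "quasi_additive (length w) (height w)"
    unfolding quasi_additive_def
  proof (intro allI impI)
    fix i j assume ij: "i + j < length w"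
    show "height w i + height w j \<le> height w (Suc (i + j)) \<and>
        height w (Suc (i + j)) \<le> height w i + height w j + 1"
      using st(1)[unfolded sturmian_iff_height, rule_format, of 0 "Suc j" "Suc i"]
        st(2)[unfolded sturmian_iff_height, rule_format, of "Suc i" "Suc j" 0] ij
      by simp
  qed
next
  assume qa: "quasi_additive (length w) (height w)"
  have st: "sturmian (x # w)" for x
  proof (rule sturmianI[where c = "height w"])
    fix i j assume "Suc j < length (x # w)" "i + Suc j \<le> length (x # w)"
    then show "height w j \<le> height (x # w) (i + Suc j) - height (x # w) i \<and>
        height (x # w) (i + Suc j) - height (x # w) i \<le> height w j + 1"
      using quasi_additiveD[OF qa, of "i - 1" j] by (cases i) auto
  qed
  then show "left_special w"
    using sturmian_sublist[OF st] by (auto simp: left_special_def sublist_Cons_right)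
qed

lemma right_special_iff: "right_special w \<longleftrightarrow> left_special (rev w)"
proof -
  have "sturmian (x # rev w) = sturmian (w @ [x])" for x
    using sturmian_rev[of "w @ [x]"] by simp
  then show ?thesis by (simp add: left_special_def right_special_def)
qed

lemma bispecial_iff:
  "bispecial w \<longleftrightarrow>
     quasi_additive (length w) (height w) \<and> quasi_additive (length w) (height (rev w))"
  by (simp add: bispecial_def right_special_iff left_special_iff)

lemma nonstrictly_bispecial_rev: "nonstrictly_bispecial (rev w) \<longleftrightarrow> nonstrictly_bispecial w"
proof -
  have "sturmian (x # rev w @ [y]) = sturmian (y # w @ [x])" for x y
    using sturmian_rev[of "y # w @ [x]"] by simp
  then show ?thesis
    by (auto simp: nonstrictly_bispecial_def strictly_bispecial_def bispecial_iff)
qed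

text \<open>The second hypothesis says that \<open>w\<close> is a palindrome. A proper window of
  \<open>x # w @ [y]\<close> is a prefix, lies inside \<open>w\<close>, or is a suffix; the
  palindrome property gives suffixes the same bounds as prefixes.\<close>

lemma strictly_bispecialI:
  assumes bi: "bispecial w"
    and eq: "\<And>k. k \<le> length w \<Longrightarrow> height (rev w) k = height w k"
  shows "strictly_bispecial w"
proof -
  have qa: "quasi_additive (length w) (height w)"
    using bi by (simp add: bispecial_iff)
  have "sturmian (x # w @ [y])" for x y
  proof (rule sturmianI[where c = "height w"])
    fix i j
    assume j: "Suc j < length (x # w @ [y])" and ij: "i + Suc j \<le> length (x # w @ [y])"
    consider "i = 0" | k where "i = Suc k" "k + j < length w" | k where "i = Suc k" "k + j = length w"
      using ij by (cases i) fastforce+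
    then show "height w j \<le> height (x # w @ [y]) (i + Suc j) - height (x # w @ [y]) i \<and>
        height (x # w @ [y]) (i + Suc j) - height (x # w @ [y]) i \<le> height w j + 1"
    proof cases
      case 1
      then show ?thesis using j by (simp add: height_append)
    next
      case 2
      then show ?thesis
        using quasi_additiveD[OF qa, of k j] by (simp add: height_append)
    next
      case 3
      have "height (rev w) j = height w (length w) - height w k"
        using height_rev[of j w] 3 by (metis add_diff_cancel_right' le_add2)
      then have "height w (length w) - height w k = height w j"
        using eq[of j] 3 by simp
      moreover have "height (w @ [y]) (Suc (k + j)) = height w (length w) + (if y = A then 1 else 0)"
        using height_snoc[of w y] 3 by simp
      ultimately show ?thesis
        using 3 by (simp add: height_append)
    qed
  qed
  then show ?thesis using bi by (simp add: strictly_bispecial_def)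
qed

section \<open>Slopes of quasi-additive functions\<close>

text \<open>Comparison of the slopes \<open>f i / (i + 1)\<close> and \<open>g j / (j + 1)\<close> along the subtractive
  Euclidean algorithm on \<open>(i + 1, j + 1)\<close>.\<close>

lemma slope_comparison:
  fixes f g :: "nat \<Rightarrow> int"
  assumes f: "\<And>i j. i + j < n \<Longrightarrow> f (Suc (i + j)) \<le> f i + g j"
    and g: "\<And>i j. i + j < n \<Longrightarrow> f i + g j \<le> g (Suc (i + j))"
    and diag: "\<And>i. i \<le> n \<Longrightarrow> (int i + 1) * f i + e \<le> (int i + 1) * g i"
  shows "i \<le> n \<Longrightarrow> j \<le> n \<Longrightarrow> (int j + 1) * f i + e \<le> (int i + 1) * g j"
proof (induction "i + j" arbitrary: i j rule: less_induct)
  case less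
  consider "i = j" | "j < i" | "i < j" by linarith
  then show ?case
  proof cases
    case 1
    then show ?thesis using diag less.prems by simp
  next
    case 2
    then obtain k where k: "i = Suc (k + j)" using less_imp_Suc_add by (metis add.commute)
    have "(int j + 1) * f k + e \<le> (int k + 1) * g j"
      using less.hyps[of k j] less.prems k by simp
    \<comment> \<open>Replacing \<open>k\<close> by \<open>i = k + j + 1\<close> adds at most
      \<open>(j + 1) * g j\<close> to the left side and exactly that to the right side.\<close>
    moreover have "(int j + 1) * f i \<le> (int j + 1) * (f k + g j)"
      using f[of k j] less.prems k by (intro mult_left_mono) auto
    ultimately show ?thesis using k by (simp add: algebra_simps)
  next
    case 3
    then obtain k where k: "j = Suc (i + k)" using less_imp_Suc_add by blast
    have "(int k + 1) * f i + e \<le> (int i + 1) * g k"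
      using less.hyps[of i k] less.prems k by simp
    moreover have "(int i + 1) * (f i + g k) \<le> (int i + 1) * g j"
      using g[of i k] less.prems k by (intro mult_left_mono) auto
    ultimately show ?thesis using k by (simp add: algebra_simps)
  qed
qed

text \<open>Quasi-additivity is what the comparison needs for the pair \<open>f\<close>,
  \<open>f + 1\<close>. Taking \<open>e = 1\<close>, which the diagonal allows since
  \<open>i + 1\<close> is at least 1, makes the inequality strict.\<close>

lemma quasi_additive_slope:
  assumes "quasi_additive n f" "i \<le> n" "j \<le> n"
  shows "(int j + 1) * f i < (int i + 1) * (f j + 1)"
proof -
  have "(int j + 1) * f i + 1 \<le> (int i + 1) * (f j + 1)"
  proof (rule slope_comparison[where n = n and g = "\<lambda>k. f k + 1"])
    fix i j assume "i + j < n"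
    from quasi_additiveD[OF assms(1) this]
    show "f (Suc (i + j)) \<le> f i + (f j + 1)" "f i + (f j + 1) \<le> f (Suc (i + j)) + 1"
      by simp_all
  qed (use assms in \<open>simp_all add: algebra_simps\<close>)
  then show ?thesis by simp
qed

text \<open>If \<open>g i < f i\<close> and \<open>f j < g j\<close>, integrality chains the slope
  bounds of \<open>f\<close> and \<open>g\<close> into a cycle with a strict inequality.\<close>

lemma quasi_additive_comparable:
  assumes f: "quasi_additive n f" and g: "quasi_additive n g"
  shows "(\<forall>k\<le>n. g k \<le> f k) \<or> (\<forall>k\<le>n. f k \<le> g k)"
proof (rule ccontr)
  assume "\<not> ?thesis"
  then obtain i j where ij: "i \<le> n" "j \<le> n" and lt: "g i < f i" "f j < g j"
    by (auto simp: not_le)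
  have "(int j + 1) * f i < (int i + 1) * (f j + 1)"
    using quasi_additive_slope[OF f ij] .
  also have "\<dots> \<le> (int i + 1) * g j"
    using lt by (intro mult_left_mono) auto
  also have "\<dots> < (int j + 1) * (g i + 1)"
    using quasi_additive_slope[OF g ij(2,1)] .
  also have "\<dots> \<le> (int j + 1) * f i"
    using lt by (intro mult_left_mono) auto
  finally show False by simp
qed

text \<open>Here \<open>f\<close> and \<open>g\<close> stand for the heights of a word and of its
  reversal, and \<open>c\<close> for its number of letters \<open>A\<close>. Comparing
  \<open>f\<close> at \<open>k\<close> with \<open>g + 1\<close> at \<open>n - k\<close> bounds
  \<open>f k\<close> from above; \<open>g \<le> f\<close> and the slope bound of \<open>f\<close>
  give the lower bound. Together they determine the floor.\<close>

lemma quasi_additive_dual_eq_div: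
  assumes f: "quasi_additive n f" and g: "quasi_additive n g"
    and dual: "\<And>k. k \<le> n \<Longrightarrow> f k + g (n - k) = c"
    and f0: "f 0 = 0" and g0: "g 0 = 0"
    and ge: "\<And>k. k \<le> n \<Longrightarrow> g k \<le> f k"
    and k: "k \<le> n"
  shows "f k = (int k + 1) * (c + 1) div (int n + 2)"
proof -
  have dual': "f (i + j) + g m = c" if "i + j + m = n" for i j m
  proof -
    have "i + j \<le> n" "n - (i + j) = m" using that by auto
    then show ?thesis using dual[of "i + j"] by simp
  qed
  have fn: "f n = c" "g n = c"
    using dual[of n] dual[of 0] f0 g0 by auto
  \<comment> \<open>This is the diagonal case of the comparison below:
    \<open>f i \<le> f (i + 1) = c - g m\<close>, while \<open>c = g n\<close> is at most
    \<open>g i + g m + 1\<close>.\<close>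
  have le: "f i \<le> g i + 1" if "i \<le> n" for i
  proof (cases "i = n")
    case False
    then have "i < n" using that by simp
    then obtain m where m: "n = Suc (i + m)"
      using less_imp_Suc_add by blast
    show ?thesis
    proof -
      have "f i + f 0 \<le> f (Suc i)"
        using quasi_additiveD(1)[OF f, of i 0] m by simp
      moreover have "f (Suc i) + g m = c"
        using dual'[of i 1 m] m by simp
      moreover have "g n \<le> g i + g m + 1"
        using quasi_additiveD(2)[OF g, of i m] m by simp
      ultimately show ?thesis using f0 fn by linarith
    qed
  qed (use fn in simp)
  have "(int (n - k) + 1) * f k + 0 \<le> (int k + 1) * (g (n - k) + 1)"
  proof (rule slope_comparison[where n = n and g = "\<lambda>k. g k + 1"])
    fix i j assume "i + j < n"
    then obtain m where m: "n = Suc (i + j + m)"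
      using less_imp_Suc_add by blast
    \<comment> \<open>Duality, with \<open>m\<close> the remaining length, turns quasi-additivity of
      \<open>g\<close> at \<open>j\<close>, \<open>m\<close> into this mixed inequality, and that of
      \<open>f\<close> at \<open>i\<close>, \<open>m\<close> into the next one.\<close>
    show "f (Suc (i + j)) \<le> f i + (g j + 1)"
      using quasi_additiveD(2)[OF g, of j m] dual'[of i "Suc j" m] dual'[of i 0 "Suc (j + m)"] m
      by simp
    show "f i + (g j + 1) \<le> g (Suc (i + j)) + 1"
      using quasi_additiveD(1)[OF f, of i m] dual'[of "Suc i" m j] dual'[of m 0 "Suc (i + j)"] m
      by (simp add: add.commute add.left_commute)
  next
    fix i assume "i \<le> n"
    then show "(int i + 1) * f i + 0 \<le> (int i + 1) * (g i + 1)"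
      using le by (simp add: mult_left_mono)
  qed (use k in auto)
  moreover have "g (n - k) = c - f k"
    using dual[OF k] by simp
  ultimately have upper: "(int n + 2) * f k \<le> (int k + 1) * (c + 1)"
    using k by (simp add: algebra_simps of_nat_diff)
  have "(int k + 1) * (c + 1) \<le> (int k + 1) * (f k + f (n - k) + 1)"
    using dual[OF k] ge[of "n - k"] by (intro mult_left_mono) auto
  also have "\<dots> < (int n + 2) * (f k + 1)"
    using quasi_additive_slope[OF f, of "n - k" k] k by (simp add: algebra_simps of_nat_diff)
  finally have lower: "(int k + 1) * (c + 1) < (int n + 2) * (f k + 1)" .
  show ?thesis
  proof (rule sym, rule int_div_pos_eq)
    show "(int k + 1) * (c + 1) = (int n + 2) * f k + ((int k + 1) * (c + 1) - (int n + 2) * f k)"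
      by simp
  qed (use upper lower in \<open>simp_all add: algebra_simps\<close>)
qed

section \<open>Digitized segments\<close>

text \<open>\<open>B # w @ [A]\<close> follows from below the segment from \<open>(0, 0)\<close> to
  \<open>(n + 2, q)\<close>. The factor \<open>k + 1\<close> accounts for the leading
  \<open>B\<close>; the bounds on \<open>q\<close> make the first and last letters \<open>B\<close>
  and \<open>A\<close>.\<close>

definition digital :: "nat \<Rightarrow> nat \<Rightarrow> word \<Rightarrow> bool" where
  "digital n q w \<longleftrightarrow> length w = n \<and> 0 < q \<and> q < n + 2 \<and>
     (\<forall>k\<le>n. height w k = (int k + 1) * int q div (int n + 2))"

lemma bispecial_imp_digital:
  assumes "bispecial w" "length w = n"
  shows "\<exists>q. digital n q w \<or> digital n q (rev w)"
proof -
  \<comment> \<open>The successor counts the final \<open>A\<close> of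
    \<open>B # w @ [A]\<close>.\<close>
  let ?q = "Suc (count_list w A)"
  have qa: "quasi_additive n (height w)" "quasi_additive n (height (rev w))"
    using assms by (auto simp: bispecial_iff)
  have dual: "height v k + height (rev v) (n - k) = height v n"
    if "length v = n" "k \<le> n" for v k
    using height_rev[of "n - k" v] that by simp
  have c: "height w n = int ?q - 1" "height (rev w) n = int ?q - 1"
    using assms(2) by (simp_all add: height_def)
  have q: "?q < n + 2"
    using count_le_length[of w A] assms(2) by simp
  from quasi_additive_comparable[OF qa] show ?thesis
  proof
    assume "\<forall>k\<le>n. height (rev w) k \<le> height w k"
    then have "height w k = (int k + 1) * (height w n + 1) div (int n + 2)" if "k \<le> n" for k
      using that dual[of w] assms(2) by (intro quasi_additive_dual_eq_div[OF qa]) auto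
    then have "digital n ?q w"
      using assms(2) q c by (simp add: digital_def add.commute)
    then show ?thesis by blast
  next
    assume "\<forall>k\<le>n. height w k \<le> height (rev w) k"
    then have "height (rev w) k = (int k + 1) * (height (rev w) n + 1) div (int n + 2)"
      if "k \<le> n" for k
      using that dual[of "rev w"] assms(2)
      by (intro quasi_additive_dual_eq_div[OF qa(2,1)]) auto
    then have "digital n ?q (rev w)"
      using assms(2) q c by (simp add: digital_def add.commute)
    then show ?thesis by blast
  qed
qed

lemma digital_height_length:
  assumes "digital n q w"
  shows "height w n = int q - 1"
proof -
  have "(int n + 1) * int q div (int n + 2) = int q - 1"
    using assms by (intro int_div_pos_eq[where r = "int n + 2 - int q"])
      (auto simp: digital_def algebra_simps)
  then show ?thesis using assms by (simp add: digital_def)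
qed

text \<open>Reversal turns the floor of \<open>(k + 1) * q / (n + 2)\<close> into its ceiling minus
  one, so the reversed word follows the segment from the other side.\<close>

lemma digital_height_rev:
  assumes "digital n q w" "k \<le> n"
  shows "height (rev w) k = ((int k + 1) * int q - 1) div (int n + 2)"
proof -
  let ?N = "int n + 2"
  let ?x = "(int k + 1) * int q"
  have "height w (n - k) = (int (n - k) + 1) * int q div ?N"
    using assms by (simp add: digital_def)
  \<comment> \<open>The left side is \<open>?N * q - ?x\<close>; dividing \<open>?x - 1\<close> by
    \<open>?N\<close> exhibits its quotient and its remainder.\<close>
  also have "(int (n - k) + 1) * int q = (int q - 1 - (?x - 1) div ?N) * ?N
      + (?N - 1 - (?x - 1) mod ?N)"
    using assms(2) div_mult_mod_eq[of "?x - 1" ?N]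
    by (simp add: of_nat_diff) (simp add: algebra_simps)
  also have "\<dots> div ?N = int q - 1 - (?x - 1) div ?N"
  proof (rule int_div_pos_eq[OF _ _])
    have "0 \<le> (?x - 1) mod ?N" "(?x - 1) mod ?N < ?N" by simp_all
    then show "0 \<le> ?N - 1 - (?x - 1) mod ?N" "?N - 1 - (?x - 1) mod ?N < ?N"
      by linarith+
  qed (simp add: mult.commute)
  finally show ?thesis
    using height_rev[of k w] digital_height_length[OF assms(1)] assms
    by (simp add: digital_def)
qed

text \<open>The two remainders add up to at most \<open>2 * N - 2\<close>, which leaves room for the
  extra 1 in the second bound.\<close>

lemma div_add_bounds:
  fixes x y :: int
  assumes "0 < N"
  shows "x div N + y div N \<le> (x + y) div N" "(x + y + 1) div N \<le> x div N + y div N + 1"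
proof -
  have *: "x = N * (x div N) + x mod N" "y = N * (y div N) + y mod N" by simp_all
  have r: "0 \<le> x mod N" "x mod N < N" "0 \<le> y mod N" "y mod N < N"
    using assms by auto
  have lin: "N * (x div N + y div N) = N * (x div N) + N * (y div N)"
    by (rule distrib_left)
  have "(N * (x div N + y div N)) div N \<le> (x + y) div N"
    using * r lin assms by (intro zdiv_mono1) linarith+
  then show "x div N + y div N \<le> (x + y) div N"
    using assms by simp
  have "(x + y + 1) div N \<le> (N * (x div N + y div N) + (2 * N - 1)) div N"
    using * r lin assms by (intro zdiv_mono1) linarith+
  also have "\<dots> = x div N + y div N + 1"
    using assms by (intro int_div_pos_eq[where r = "N - 1"]) (auto simp: algebra_simps)
  finally show "(x + y + 1) div N \<le> x div N + y div N + 1" .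
qed

lemma digital_bispecial:
  assumes "digital n q w"
  shows "bispecial w"
proof -
  let ?N = "int n + 2"
  have len: "length w = n" using assms by (simp add: digital_def)
  have "quasi_additive n (height w)"
    unfolding quasi_additive_def
  proof (intro allI impI)
    fix i j assume ij: "i + j < n"
    let ?x = "(int i + 1) * int q" and ?y = "(int j + 1) * int q"
    have "?x + ?y = (int (Suc (i + j)) + 1) * int q" by (simp add: algebra_simps)
    moreover have "(?x + ?y) div ?N \<le> (?x + ?y + 1) div ?N"
      by (intro zdiv_mono1) auto
    ultimately show "height w i + height w j \<le> height w (Suc (i + j)) \<and>
        height w (Suc (i + j)) \<le> height w i + height w j + 1"
      using assms ij div_add_bounds[of ?N ?x ?y] by (simp add: digital_def)
  qed
  moreover have "quasi_additive n (height (rev w))"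
    unfolding quasi_additive_def
  proof (intro allI impI)
    fix i j assume ij: "i + j < n"
    let ?x = "(int i + 1) * int q - 1" and ?y = "(int j + 1) * int q - 1"
    \<comment> \<open>Each argument of the reversed height carries a \<open>- 1\<close>, so two of
      them exceed the joint one by a \<open>- 1\<close>; the extra 1 of
      \<open>div_add_bounds\<close> compensates.\<close>
    have "?x + ?y + 1 = (int (Suc (i + j)) + 1) * int q - 1" by (simp add: algebra_simps)
    moreover have "(?x + ?y) div ?N \<le> (?x + ?y + 1) div ?N"
      by (intro zdiv_mono1) auto
    ultimately show "height (rev w) i + height (rev w) j \<le> height (rev w) (Suc (i + j)) \<and>
        height (rev w) (Suc (i + j)) \<le> height (rev w) i + height (rev w) j + 1"
      using ij div_add_bounds[of ?N ?x ?y] digital_height_rev[OF assms] by simp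
  qed
  ultimately show ?thesis by (simp add: bispecial_iff len)
qed

section \<open>Lattice points and strictness\<close>

lemma div_pred:
  fixes x N :: int
  assumes "0 < N"
  shows "(x - 1) div N = x div N - (if N dvd x then 1 else 0)"
proof (cases "N dvd x")
  case True
  then obtain c where "x = N * c" by blast
  then have "(x - 1) div N = c - 1"
    using assms by (intro int_div_pos_eq[where r = "N - 1"]) (auto simp: algebra_simps)
  then show ?thesis using True \<open>x = N * c\<close> assms by simp
next
  case False
  then have "0 \<noteq> x mod N" "0 \<le> x mod N" "x mod N < N"
    using assms by (simp_all add: dvd_eq_mod_eq_0)
  then have "(x - 1) div N = x div N"
    by (intro int_div_pos_eq[where r = "x mod N - 1"]) auto
  then show ?thesis using False by simp
qed

text \<open>Floor and ceiling minus one differ exactly where the segment passes through a lattice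
  point, here one with abscissa \<open>k + 1\<close>.\<close>

lemma digital_height_rev_eq:
  assumes "digital n q w" "k \<le> n"
  shows "height (rev w) k = height w k - (if n + 2 dvd Suc k * q then 1 else 0)"
proof -
  have "int n + 2 dvd (int k + 1) * int q \<longleftrightarrow> n + 2 dvd Suc k * q"
    by (metis (no_types) int_dvd_int_iff int_ops(2,7) of_nat_Suc of_nat_add of_nat_numeral add.commute)
  then show ?thesis
    using digital_height_rev[OF assms] assms div_pred[of "int n + 2" "(int k + 1) * int q"]
    by (simp add: digital_def)
qed

text \<open>For a common divisor \<open>d > 1\<close>, the witness is \<open>k + 1 = N / d\<close>,
  the abscissa of an inner lattice point.\<close>

lemma not_coprime_imp_dvd_mult:
  fixes q N :: nat
  assumes "\<not> coprime q N" "0 < N"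
  shows "\<exists>k. Suc k < N \<and> N dvd Suc k * q"
proof -
  from assms(1) obtain d where "d dvd q" "d dvd N" and d: "d \<noteq> 1"
    by (auto elim: not_coprimeE)
  then obtain a b where a: "q = d * a" and b: "N = d * b"
    by (auto elim!: dvdE)
  have "0 < b" "1 < d" using assms(2) b d by (auto intro: Nat.gr0I)
  then have "b < N" by (simp add: b)
  moreover have "N dvd b * q" by (simp add: a b)
  ultimately show ?thesis using \<open>0 < b\<close> by (intro exI[of _ "b - 1"]) simp
qed

lemma digital_nonstrictly_bispecial_iff:
  assumes d: "digital n q w"
  shows "nonstrictly_bispecial w \<longleftrightarrow> \<not> coprime q (n + 2)"
proof
  assume ns: "nonstrictly_bispecial w"
  show "\<not> coprime q (n + 2)"
  proof
    assume co: "coprime q (n + 2)"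
    have "\<not> n + 2 dvd Suc k * q" if "k \<le> n" for k
    proof
      assume "n + 2 dvd Suc k * q"
      then have "n + 2 dvd Suc k"
        using co by (metis coprime_commute coprime_dvd_mult_left_iff)
      then show False using that by (auto dest: dvd_imp_le)
    qed
    then have "height (rev w) k = height w k" if "k \<le> n" for k
      using that digital_height_rev_eq[OF d that] by simp
    then have "strictly_bispecial w"
      using d digital_bispecial by (intro strictly_bispecialI) (auto simp: digital_def)
    then show False using ns by (simp add: nonstrictly_bispecial_def)
  qed
next
  assume "\<not> coprime q (n + 2)"
  then obtain k where "Suc k < n + 2" and dvd: "n + 2 dvd Suc k * q"
    using not_coprime_imp_dvd_mult[of q "n + 2"] by (meson add_pos_pos zero_less_numeral add_nonneg_pos zero_le)
  then have k: "k \<le> n" by simp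
  have len: "length w = n" using d by (simp add: digital_def)
  have "height (rev w) k = height w k - 1"
    using digital_height_rev_eq[OF d k] dvd by simp
  then have eq: "height w n - height w (n - k) = height w k - 1"
    using height_rev[of k w] k len by simp
  \<comment> \<open>The prefix of length \<open>k + 1\<close> has \<open>height w k + 1\<close>
    letters \<open>A\<close>, the suffix of that length only \<open>height w k - 1\<close>.\<close>
  have "\<not> sturmian (A # w @ [B])"
  proof
    assume "sturmian (A # w @ [B])"
    from this[unfolded sturmian_iff_height, rule_format, of 0 "Suc k" "Suc (n - k)"]
    show False
      using k len eq height_snoc[of w B] by (simp add: height_append)
  qed
  then show "nonstrictly_bispecial w"
    using digital_bispecial[OF d] by (simp add: nonstrictly_bispecial_def strictly_bispecial_def)
qed

section \<open>Counting\<close>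

lemma digital_unique: "digital n q v \<Longrightarrow> digital n q w \<Longrightarrow> v = w"
  by (rule height_eqI) (auto simp: digital_def)

lemma digital_slope_unique: "digital n p w \<Longrightarrow> digital n q w \<Longrightarrow> p = q"
  using digital_height_length[of n p w] digital_height_length[of n q w] by simp

lemma digital_exists:
  assumes "0 < q" "q < n + 2"
  shows "\<exists>w. digital n q w"
proof -
  let ?h = "\<lambda>k. (int k + 1) * int q div (int n + 2)"
  define w where "w = map (\<lambda>k. if ?h k < ?h (Suc k) then A else B) [0..<n]"
  \<comment> \<open>Since \<open>q < n + 2\<close>, the floor rises by 0 or 1 at each step, so a
    letter can encode the increment.\<close>
  have step: "?h k \<le> ?h (Suc k) \<and> ?h (Suc k) \<le> ?h k + 1" for k
  proof -
    let ?x = "(int k + 1) * int q"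
    have "?x + int q = (int (Suc k) + 1) * int q" by (simp add: algebra_simps)
    moreover have "?x div (int n + 2) \<le> (?x + int q) div (int n + 2)"
      by (intro zdiv_mono1) auto
    moreover have "(?x + int q) div (int n + 2) \<le> (?x + (int n + 2)) div (int n + 2)"
      using assms by (intro zdiv_mono1) auto
    ultimately show ?thesis by simp
  qed
  have "height w k = ?h k" if "k \<le> n" for k
    using that
  proof (induction k)
    case 0
    then show ?case using assms by simp
  next
    case (Suc k)
    then have "w ! k = (if ?h k < ?h (Suc k) then A else B)"
      by (simp add: w_def)
    then show ?case
      using height_Suc[of k w] Suc step[of k] by (auto simp: w_def split: if_splits)
  qed
  then show ?thesis using assms by (intro exI[of _ w]) (simp add: digital_def w_def)
qed

lemma card_not_coprime:
  assumes "1 < N"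
  shows "card {q. 0 < q \<and> q < N \<and> \<not> coprime q N} + totient N = N - 1"
proof -
  \<comment> \<open>The bound \<open>q \<le> N\<close> becomes strict because \<open>N > 1\<close>
    is not coprime to itself.\<close>
  have "totatives N = {q. 0 < q \<and> q < N \<and> coprime q N}"
    using assms by (auto simp: totatives_def order_le_less)
  moreover have "{q. 0 < q \<and> q < N \<and> \<not> coprime q N} \<union> {q. 0 < q \<and> q < N \<and> coprime q N} = {0<..<N}"
    by auto
  moreover have "card ({q. 0 < q \<and> q < N \<and> \<not> coprime q N} \<union> {q. 0 < q \<and> q < N \<and> coprime q N})
      = card {q. 0 < q \<and> q < N \<and> \<not> coprime q N} + card {q. 0 < q \<and> q < N \<and> coprime q N}"
    by (intro card_Un_disjoint) auto
  ultimately show ?thesis by (simp add: totient_def)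
qed

theorem proposition4p1:
  fixes n :: nat
  assumes "n > 1"
  shows "int (card {w :: word. length w = n \<and> nonstrictly_bispecial w})
           = 2 * (int n + 1 - int (totient (n + 2)))"
proof -
  define Q where "Q = {q. 0 < q \<and> q < n + 2 \<and> \<not> coprime q (n + 2)}"
  define L where "L = {w. \<exists>q\<in>Q. digital n q w}"
  have "\<forall>q\<in>Q. \<exists>w. digital n q w"
    by (simp add: Q_def digital_exists)
  then obtain word where word: "\<And>q. q \<in> Q \<Longrightarrow> digital n q (word q)"
    by metis
  have finQ: "finite Q" by (simp add: Q_def)
  have L: "L = word ` Q"
    using word digital_unique unfolding L_def by blast
  have "inj_on word Q"
    using word digital_slope_unique by (metis inj_onI)
  then have card: "card L = card Q" and finL: "finite L"
    using L finQ by (simp_all add: card_image)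
  have "{w. length w = n \<and> nonstrictly_bispecial w} = L \<union> rev ` L"
  proof (intro set_eqI iffI)
    fix w assume "w \<in> {w. length w = n \<and> nonstrictly_bispecial w}"
    then have w: "length w = n" "nonstrictly_bispecial w" "bispecial w"
      by (auto simp: nonstrictly_bispecial_def)
    have in_L: "v \<in> L" if "digital n q v" "nonstrictly_bispecial v" for q v
      using that digital_nonstrictly_bispecial_iff[OF that(1)]
      by (auto simp: L_def Q_def digital_def)
    have "w \<in> L \<or> rev w \<in> L"
      using bispecial_imp_digital[OF w(3,1)] in_L w(2) nonstrictly_bispecial_rev by blast
    then show "w \<in> L \<union> rev ` L"
      by (metis UnI1 UnI2 image_eqI rev_rev_ident)
  next
    fix w assume "w \<in> L \<union> rev ` L"
    moreover have "length v = n \<and> nonstrictly_bispecial v" if "v \<in> L" for v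
      using that digital_nonstrictly_bispecial_iff by (auto simp: L_def Q_def digital_def)
    ultimately show "w \<in> {w. length w = n \<and> nonstrictly_bispecial w}"
      by (auto simp: nonstrictly_bispecial_rev)
  qed
  \<comment> \<open>A common word and its reversal have equally many letters \<open>A\<close>, hence
    the same \<open>q\<close>; the word is then a palindrome, which an inner lattice point
    forbids.\<close>
  moreover have "L \<inter> rev ` L = {}"
  proof (rule ccontr)
    assume "L \<inter> rev ` L \<noteq> {}"
    then obtain w where "w \<in> L" "rev w \<in> L" by auto
    then obtain p q where q: "q \<in> Q" "digital n q w" and p: "digital n p (rev w)"
      by (auto simp: L_def)
    have len: "length w = n" using q(2) by (simp add: digital_def)
    have "height (rev w) n = height w n"
      using height_rev[of n w] len by simp
    then have "p = q"
      using digital_height_length[OF p] digital_height_length[OF q(2)] by simp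
    then have "rev w = w" using p q(2) digital_unique by blast
    moreover obtain k where "Suc k < n + 2" "n + 2 dvd Suc k * q"
      using not_coprime_imp_dvd_mult[of q "n + 2"] q(1)
      by (auto simp only: Q_def add_nonneg_pos zero_le zero_less_numeral)
    ultimately show False
      using digital_height_rev_eq[OF q(2), of k] by simp
  qed
  ultimately have "card {w. length w = n \<and> nonstrictly_bispecial w} = 2 * card Q"
    using finL card by (simp add: card_Un_disjoint card_image)
  moreover have "int (card Q) = int n + 1 - int (totient (n + 2))"
  proof -
    have "card Q + totient (n + 2) = n + 1"
      using card_not_coprime[of "n + 2"] by (simp add: Q_def)
    from arg_cong[OF this, of int] show ?thesis
      unfolding of_nat_add of_nat_1 by linarith
  qed
  ultimately show ?thesis by simp
qed

end
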